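(* Let $G\subset O(n)$ be a closed subgroup which is not transitive on $S_{n-1}$. Put $R:=\sup_{v\in S_{n-1}} r_v$ and $r:=\inf_{v\in S_{n-1}} r_v$. Then $$\frac12\leq \frac{r}{R}\leq 1.$$
   Context: $\mathbb{R}^n$ carries the canonical inner product and norm $\|\cdot\|$; $S_{n-1}=\{v\in\mathbb{R}^n : \|v\|=1\}$. For $v\in S_{n-1}$ put $h_v(w):=\inf_{g\in G}\|w-g(v)\|$ and $r_v:=\sup_{\|w\|=1}h_v(w)$, which is the Hausdorff distance between the orbit $P_G(v)=\{g(v) : g\in G\}$ and the sphere $S_{n-1}$. ($R$ and $r$ are the distances realized by the so-called lazy and busy orbits.) $G$ is transitive if some orbit $P_G(v)$, $v\in S_{n-1}$, equals $S_{n-1}$. *)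

theory Defs
  imports "HOL-Analysis.Analysis" "HOL-Algebra.Group"
begin

definition orthogonal_group :: "(real^'n^'n) monoid" where
  "orthogonal_group =
     \<lparr>carrier = {A. orthogonal_matrix A}, mult = (**), one = mat 1\<rparr>"

lemma group_orthogonal_group: "group (orthogonal_group :: (real^'n^'n) monoid)"
proof (rule groupI)
  fix A :: "real^'n^'n"
  assume "A \<in> carrier orthogonal_group"
  then have "transpose A \<in> carrier orthogonal_group"
    "transpose A \<otimes>\<^bsub>orthogonal_group\<^esub> A = \<one>\<^bsub>orthogonal_group\<^esub>"
    by (auto simp: orthogonal_group_def orthogonal_matrix_def)
  then show "\<exists>B\<in>carrier orthogonal_group.
      B \<otimes>\<^bsub>orthogonal_group\<^esub> A = \<one>\<^bsub>orthogonal_group\<^esub>"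
    by blast
qed (auto simp: orthogonal_group_def orthogonal_matrix_mul orthogonal_matrix_id matrix_mul_assoc)

definition sphere_orbit :: "(real^'n^'n) set \<Rightarrow> real^'n \<Rightarrow> (real^'n) set" where
  "sphere_orbit G v = {A *v v | A. A \<in> G}"

definition transitive_on_sphere :: "(real^'n^'n) set \<Rightarrow> bool" where
  "transitive_on_sphere G \<longleftrightarrow> (\<exists>v\<in>sphere 0 1. sphere_orbit G v = sphere 0 1)"

definition orbit_dist :: "(real^'n^'n) set \<Rightarrow> real^'n \<Rightarrow> real^'n \<Rightarrow> real" where
  "orbit_dist G v w = (INF A\<in>G. norm (w - A *v v))"

text \<open>Since the orbit of a unit vector under orthogonal matrices is contained in the unit sphere,
  the following is the Hausdorff distance between that orbit and the sphere.\<close>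

definition orbit_radius :: "(real^'n^'n) set \<Rightarrow> real^'n \<Rightarrow> real" where
  "orbit_radius G v = (SUP w\<in>sphere 0 1. orbit_dist G v w)"

end

theory Submission
  imports Defs
begin

text \<open>The function \<open>orbit_dist G\<close> is the quotient pseudometric on the sphere modulo \<open>G\<close>, so
  \<open>R\<close> and \<open>r\<close> are the diameter and the (Chebyshev) radius of one bounded pseudometric space, whence
  \<open>r \<le> R \<le> 2 r\<close>. Since \<open>G\<close> is compact, orbits are closed; hence non-transitivity gives \<open>R > 0\<close>.\<close>

text \<open>Boundedness is what has to be added to closedness: the rows of an orthogonal matrix are
  unit vectors, so its norm is at most the number of rows.\<close>

lemma compact_closed_orthogonal_matrices:
  fixes G :: "(real^'n^'n) set"
  assumes "closed G" and "\<And>A. A \<in> G \<Longrightarrow> orthogonal_matrix A"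
  shows "compact G"
proof -
  have "norm A \<le> real CARD('n)" if "A \<in> G" for A
  proof -
    have "norm (A $ i) = 1" for i
      using assms(2)[OF that]
      by (simp add: orthogonal_matrix_orthonormal_rows row_def)
    then show ?thesis
      using L2_set_le_sum[of UNIV "\<lambda>i. norm (A $ i)"] by (simp add: norm_vec_def)
  qed
  then show ?thesis
    using assms(1) by (auto simp: compact_eq_bounded_closed bounded_iff)
qed

lemma compact_sphere_orbit: "compact G \<Longrightarrow> compact (sphere_orbit G v)"
  unfolding sphere_orbit_def Setcompr_eq_image
  by (intro compact_continuous_image)
    (auto simp: matrix_vector_mult_def intro!: continuous_intros)

lemma norm_orthogonal_matrix_mult:
  fixes A :: "real^'n^'n"
  shows "orthogonal_matrix A \<Longrightarrow> norm (A *v x) = norm x"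
  using orthogonal_transformation_norm[of "(*v) A" x]
  by (simp add: orthogonal_transformation_matrix matrix_vector_mul_linear)

lemma orbit_dist_le: "A \<in> G \<Longrightarrow> orbit_dist G v w \<le> norm (w - A *v v)"
  unfolding orbit_dist_def by (rule cINF_lower) (auto intro: bdd_belowI2[of _ 0])

lemma orbit_dist_nonneg: "G \<noteq> {} \<Longrightarrow> 0 \<le> orbit_dist G v w"
  unfolding orbit_dist_def by (rule cINF_greatest) auto

text \<open>\<open>orbit_dist G v w\<close> is the distance from \<open>w\<close> to the orbit of
  \<open>v\<close>. That orbit is a continuous image of the compact \<open>G\<close>, hence closed,
  so a point outside it has positive distance.\<close>

lemma orbit_dist_pos:
  assumes "compact G" "G \<noteq> {}" "w \<notin> sphere_orbit G v"
  shows "0 < orbit_dist G v w"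
proof -
  have ne: "sphere_orbit G v \<noteq> {}"
    using assms(2) by (auto simp: sphere_orbit_def)
  have "orbit_dist G v w = infdist w (sphere_orbit G v)"
    using ne by (simp add: orbit_dist_def infdist_def sphere_orbit_def Setcompr_eq_image image_image dist_norm)
  moreover have "closed (sphere_orbit G v)"
    using assms(1) by (simp add: compact_sphere_orbit compact_imp_closed)
  ultimately show ?thesis
    using infdist_pos_not_in_closed ne assms(3) by metis
qed

text \<open>A near-optimal \<open>B\<close> for the pair \<open>u\<close>, \<open>v\<close> and a
  near-optimal \<open>A\<close> for \<open>v\<close>, \<open>w\<close> combine to the candidate
  \<open>A ** B\<close> for \<open>u\<close>, \<open>w\<close>; as \<open>A\<close> is an isometry,
  it carries the first error over unchanged.\<close>

lemma orbit_dist_triangle: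
  fixes G :: "(real^'n^'n) set"
  assumes "G \<noteq> {}" and orth: "\<And>A. A \<in> G \<Longrightarrow> orthogonal_matrix A"
    and mult: "\<And>A B. A \<in> G \<Longrightarrow> B \<in> G \<Longrightarrow> A ** B \<in> G"
  shows "orbit_dist G u w \<le> orbit_dist G u v + orbit_dist G v w"
proof -
  have *: "orbit_dist G u w \<le> norm (v - B *v u) + norm (w - A *v v)" if "A \<in> G" "B \<in> G" for A B
  proof -
    have "orbit_dist G u w \<le> norm (w - (A ** B) *v u)"
      by (intro orbit_dist_le mult that)
    also have "w - (A ** B) *v u = (w - A *v v) + A *v (v - B *v u)"
      by (simp add: matrix_vector_mul_assoc matrix_vector_mult_diff_distrib)
    also have "norm \<dots> \<le> norm (w - A *v v) + norm (v - B *v u)"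
      using norm_triangle_ineq norm_orthogonal_matrix_mult[OF orth[OF that(1)]] by metis
    finally show ?thesis by simp
  qed
  \<comment> \<open>The infima are taken one at a time: over \<open>B\<close> with \<open>A\<close>
    fixed, then over \<open>A\<close>.\<close>
  have "orbit_dist G u w - orbit_dist G u v \<le> norm (w - A *v v)" if "A \<in> G" for A
  proof -
    have "orbit_dist G u w - norm (w - A *v v) \<le> orbit_dist G u v"
      unfolding orbit_dist_def[of G u v] using assms(1)
      by (rule cINF_greatest) (use *[OF that] in \<open>simp add: algebra_simps\<close>)
    then show ?thesis by simp
  qed
  then have "orbit_dist G u w - orbit_dist G u v \<le> orbit_dist G v w"
    unfolding orbit_dist_def[of G v w] using assms(1) by (intro cINF_greatest)
  then show ?thesis by simp
qed

text \<open>Applying the isometry \<open>transpose A\<close>, the inverse of \<open>A\<close>, turns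
  the distance from \<open>v\<close> to \<open>A *v w\<close> into the distance from
  \<open>transpose A *v v\<close> to \<open>w\<close>.\<close>

lemma orbit_dist_commute:
  fixes G :: "(real^'n^'n) set"
  assumes "G \<noteq> {}" and orth: "\<And>A. A \<in> G \<Longrightarrow> orthogonal_matrix A"
    and transp: "\<And>A. A \<in> G \<Longrightarrow> transpose A \<in> G"
  shows "orbit_dist G v w = orbit_dist G w v"
proof -
  have "orbit_dist G v w \<le> orbit_dist G w v" for v w
    unfolding orbit_dist_def[of G w v] using assms(1)
  proof (rule cINF_greatest)
    fix A assume A: "A \<in> G"
    have "w - transpose A *v v = - (transpose A *v (v - A *v w))"
      using orth[OF A]
      by (simp add: matrix_vector_mult_diff_distrib matrix_vector_mul_assoc orthogonal_matrix)
    then have "norm (w - transpose A *v v) = norm (v - A *v w)"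
      using norm_orthogonal_matrix_mult[OF orth[OF transp[OF A]]] by simp
    then show "orbit_dist G v w \<le> norm (v - A *v w)"
      using orbit_dist_le[OF transp[OF A], of v w] by simp
  qed
  then show ?thesis by (simp add: order_antisym)
qed

lemma subgroup_orthogonal_group:
  fixes G :: "(real^'n^'n) set"
  assumes "subgroup G orthogonal_group"
  shows subgroup_orthogonal_matrix: "A \<in> G \<Longrightarrow> orthogonal_matrix A"
    and subgroup_orthogonal_mult: "A \<in> G \<Longrightarrow> B \<in> G \<Longrightarrow> A ** B \<in> G"
    and subgroup_orthogonal_one: "mat 1 \<in> G"
    and subgroup_orthogonal_transpose: "A \<in> G \<Longrightarrow> transpose A \<in> G"
proof -
  show orth: "orthogonal_matrix A" if "A \<in> G" for A
    using subgroup.mem_carrier[OF assms that] by (simp add: orthogonal_group_def)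
  show "A \<in> G \<Longrightarrow> B \<in> G \<Longrightarrow> A ** B \<in> G"
    using subgroup.m_closed[OF assms] by (simp add: orthogonal_group_def)
  show "mat 1 \<in> G"
    using subgroup.one_closed[OF assms] by (simp add: orthogonal_group_def)
  assume A: "A \<in> G"
  have "inv\<^bsub>orthogonal_group\<^esub> A = transpose A"
    using orth[OF A]
    by (intro group.inv_equality[OF group_orthogonal_group])
      (auto simp: orthogonal_group_def orthogonal_matrix_def)
  then show "transpose A \<in> G"
    using subgroup.m_inv_closed[OF assms A] by simp
qed

theorem theorem3:
  fixes G :: "(real^'n^'n) set" and R r :: real
  assumes "subgroup G orthogonal_group"
    and "closed G"
    and "\<not> transitive_on_sphere G"
    and "R = (SUP v\<in>sphere 0 1. orbit_radius G v)"
    and "r = (INF v\<in>sphere 0 1. orbit_radius G v)"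
  shows "1 / 2 \<le> r / R \<and> r / R \<le> 1"
proof -
  note G = subgroup_orthogonal_group[OF assms(1)]
  have ne: "G \<noteq> {}" using G(3) by blast
  obtain v\<^sub>0 :: "real^'n" where v0: "v\<^sub>0 \<in> sphere 0 1"
    using vector_choose_size[of 1] by auto
  have S_ne: "sphere (0::real^'n) 1 \<noteq> {}" using v0 by blast
  \<comment> \<open>The identity matrix as competitor gives the bound 2, the diameter of the sphere.
    It makes the suprema below range over bounded sets.\<close>
  have dist_le_2: "orbit_dist G v w \<le> 2" if "v \<in> sphere 0 1" "w \<in> sphere 0 1" for v w
    using orbit_dist_le[OF G(3), of v w] norm_triangle_ineq4[of w v] that by simp
  have dist_le_radius: "orbit_dist G v w \<le> orbit_radius G v"
    if "v \<in> sphere 0 1" "w \<in> sphere 0 1" for v w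
    unfolding orbit_radius_def using that dist_le_2
    by (intro cSUP_upper) (auto intro!: bdd_aboveI2[of _ _ 2])
  have radius_nonneg: "0 \<le> orbit_radius G v" if "v \<in> sphere 0 1" for v
    using dist_le_radius[OF that v0] orbit_dist_nonneg[OF ne, of v v\<^sub>0] by linarith
  have radius_le_2: "orbit_radius G v \<le> 2" if "v \<in> sphere 0 1" for v
    unfolding orbit_radius_def using S_ne dist_le_2[OF that] by (rule cSUP_least)
  have radius_le_R: "orbit_radius G v \<le> R" if "v \<in> sphere 0 1" for v
    unfolding assms(4) using that radius_le_2
    by (intro cSUP_upper) (auto intro!: bdd_aboveI2[of _ _ 2])
  have r_le_radius: "r \<le> orbit_radius G v" if "v \<in> sphere 0 1" for v
    unfolding assms(5) using that radius_nonneg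
    by (intro cINF_lower) (auto intro!: bdd_belowI2[of _ 0])
  \<comment> \<open>Go from \<open>u\<close> to \<open>w\<close> through \<open>v\<close>: by
    symmetry both legs start at \<open>v\<close>, and each is at most
    \<open>orbit_radius G v\<close>.\<close>
  have radius_le_twice: "orbit_radius G u \<le> 2 * orbit_radius G v"
    if u: "u \<in> sphere 0 1" and v: "v \<in> sphere 0 1" for u v
    unfolding orbit_radius_def[of G u] using S_ne
  proof (rule cSUP_least)
    fix w :: "real^'n" assume w: "w \<in> sphere 0 1"
    have "orbit_dist G u w \<le> orbit_dist G u v + orbit_dist G v w"
      by (intro orbit_dist_triangle ne G)
    also have "orbit_dist G u v = orbit_dist G v u"
      by (intro orbit_dist_commute ne G)
    finally show "orbit_dist G u w \<le> 2 * orbit_radius G v"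
      using dist_le_radius[OF v u] dist_le_radius[OF v w] by linarith
  qed
  have "R \<le> 2 * orbit_radius G v" if "v \<in> sphere 0 1" for v
    unfolding assms(4) using S_ne radius_le_twice[OF _ that] by (rule cSUP_least)
  then have "R / 2 \<le> orbit_radius G v" if "v \<in> sphere 0 1" for v
    using that by (simp add: mult.commute)
  then have "R / 2 \<le> r"
    unfolding assms(5) using S_ne by (intro cINF_greatest)
  moreover have "r \<le> R"
    using r_le_radius[OF v0] radius_le_R[OF v0] by linarith
  \<comment> \<open>Strict positivity matters: for \<open>R = 0\<close> the quotient
    \<open>r / R\<close> would be 0 and the lower bound would fail. Any single orbit suffices here,
    since by non-transitivity it misses a point of the sphere.\<close>
  moreover have "0 < R"
  proof -
    have "sphere_orbit G v\<^sub>0 \<subseteq> sphere 0 1"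
      using v0 norm_orthogonal_matrix_mult[OF G(1)] by (auto simp: sphere_orbit_def)
    then obtain w where w: "w \<in> sphere 0 1" "w \<notin> sphere_orbit G v\<^sub>0"
      using assms(3) v0 unfolding transitive_on_sphere_def by blast
    have "0 < orbit_dist G v\<^sub>0 w"
      by (intro orbit_dist_pos compact_closed_orthogonal_matrices assms(2) G(1) ne w(2))
    then show ?thesis
      using dist_le_radius[OF v0 w(1)] radius_le_R[OF v0] by linarith
  qed
  ultimately show ?thesis by (simp add: field_simps)
qed

end
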